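(* For $n\geq 1$ let $$M(n)=\begin{pmatrix}s(n)&s(n+1)\\ t(n)&t(n+1)\end{pmatrix}.$$ Then $\det(M(n))=-2(-1)^k$ whenever $2^k\leq n<2^{k+1}$. In particular $|\det(M(n))|=2$ and $M(n)$ is invertible for all $n\geq 1$.
   Context: The Stern sequence $s$ is defined by $s(0)=0$, $s(1)=1$, $s(2n)=s(n)$, $s(2n+1)=s(n)+s(n+1)$ for $n\geq1$. The twisted Stern sequence $t$ is defined by $t(0)=0$, $t(1)=1$, $t(2n)=-t(n)$, $t(2n+1)=-t(n)-t(n+1)$ for $n\geq 1$. *)

theory Defs
  imports "HOL-Analysis.Analysis"
begin

(* The sequences are integer-valued; the four defining equations of each one
   are derived below from the single recursive equation. *)

function stern :: "nat \<Rightarrow> int" where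
  "stern n =
     (if n = 0 then 0
      else if n = 1 then 1
      else if even n then stern (n div 2)
      else stern (n div 2) + stern (n div 2 + 1))"
  by pat_completeness auto
termination
  by (relation "Wellfounded.measure id") (auto elim!: oddE)

function twisted_stern :: "nat \<Rightarrow> int" where
  "twisted_stern n =
     (if n = 0 then 0
      else if n = 1 then 1
      else if even n then - twisted_stern (n div 2)
      else - twisted_stern (n div 2) - twisted_stern (n div 2 + 1))"
  by pat_completeness auto
termination
  by (relation "Wellfounded.measure id") (auto elim!: oddE)

declare stern.simps [simp del] twisted_stern.simps [simp del]

lemma stern_0: "stern 0 = 0"
  and stern_1: "stern 1 = 1"
  by (simp_all add: stern.simps)

lemma stern_even: "n \<ge> 1 \<Longrightarrow> stern (2 * n) = stern n"
  by (subst stern.simps) auto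

lemma stern_odd: "n \<ge> 1 \<Longrightarrow> stern (2 * n + 1) = stern n + stern (n + 1)"
  by (subst stern.simps) auto

lemma twisted_stern_0: "twisted_stern 0 = 0"
  and twisted_stern_1: "twisted_stern 1 = 1"
  by (simp_all add: twisted_stern.simps)

lemma twisted_stern_even: "n \<ge> 1 \<Longrightarrow> twisted_stern (2 * n) = - twisted_stern n"
  by (subst twisted_stern.simps) auto

lemma twisted_stern_odd:
  "n \<ge> 1 \<Longrightarrow> twisted_stern (2 * n + 1) = - twisted_stern n - twisted_stern (n + 1)"
  by (subst twisted_stern.simps) auto

(* The entries are taken in the rationals: a determinant of absolute value 2
   is not a unit of the integers, so invertibility is meant over a field. *)

definition stern_matrix :: "nat \<Rightarrow> rat ^ 2 ^ 2" where
  "stern_matrix n =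
     vector [vector [of_int (stern n), of_int (stern (n + 1))],
             vector [of_int (twisted_stern n), of_int (twisted_stern (n + 1))]]"

end

(* Both M(2n) and M(2n+1) arise from M(n) by integer row and column operations that
   reverse the sign of the determinant, so det M(n) only depends on the number of
   halvings that lead from n to 1, and det M(1) = -2. *)
theory Submission
  imports Defs
begin

text \<open>Integer-valued, so that the recursion is plain integer algebra;
  \<open>det_stern_matrix\<close> carries the result over to the rationals.\<close>

definition stern_det :: "nat \<Rightarrow> int" where
  "stern_det n = stern n * twisted_stern (n + 1) - stern (n + 1) * twisted_stern n"

lemma det_stern_matrix: "det (stern_matrix n) = of_int (stern_det n)"
  by (simp add: stern_matrix_def stern_det_def det_2)

lemma stern_det_1: "stern_det 1 = - 2"
  using stern_even[of 1] twisted_stern_even[of 1]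
  by (simp add: stern_det_def stern_1[simplified] twisted_stern_1[simplified] numeral_2_eq_2)

text \<open>Adding the first column of M(n) to the second and negating the second row gives
  M(2n).\<close>

lemma stern_det_even:
  assumes "n \<ge> 1"
  shows "stern_det (2 * n) = - stern_det n"
  unfolding stern_det_def stern_even[OF assms] twisted_stern_even[OF assms]
    stern_odd[OF assms] twisted_stern_odd[OF assms]
  by (simp add: algebra_simps)

text \<open>Here the second column is added to the first before the second row is negated.\<close>

lemma stern_det_odd:
  assumes "n \<ge> 1"
  shows "stern_det (2 * n + 1) = - stern_det n"
proof -
  \<comment> \<open>The second column has an even index, so the even rules apply to it at n +
    1.\<close>
  have "2 * n + 1 + 1 = 2 * (n + 1)" by simp
  then show ?thesis
    unfolding stern_det_def
    by (simp only: stern_even twisted_stern_even stern_odd[OF assms]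
        twisted_stern_odd[OF assms] le_add2) (simp add: algebra_simps)
qed

lemma stern_det_dyadic:
  assumes "2 ^ k \<le> n" "n < 2 ^ (k + 1)"
  shows "stern_det n = - 2 * (- 1) ^ k"
  using assms
proof (induction k arbitrary: n)
  case 0
  then have "n = 1" by simp
  then show ?case using stern_det_1 by simp
next
  case (Suc k)
  \<comment> \<open>Rounding down is harmless for either parity of n: the bounds on n are even
    numbers.\<close>
  have bounds: "2 ^ k \<le> n div 2" "n div 2 < 2 ^ (k + 1)"
    using Suc.prems by auto
  have "n div 2 \<ge> 1"
    using bounds(1) one_le_power[of "2::nat" k] by linarith
  then have "stern_det n = - stern_det (n div 2)"
    using stern_det_even[of "n div 2"] stern_det_odd[of "n div 2"]
    by (cases "even n") simp_all
  then show ?case using Suc.IH[OF bounds] by simp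
qed

theorem mainTheorem7:
  fixes n :: nat
  assumes "n \<ge> 1"
  shows "(\<forall>k::nat. 2 ^ k \<le> n \<and> n < 2 ^ (k + 1) \<longrightarrow> det (stern_matrix n) = - 2 * (- 1) ^ k)
         \<and> \<bar>det (stern_matrix n)\<bar> = 2
         \<and> invertible (stern_matrix n)"
proof -
  have dyadic: "det (stern_matrix n) = - 2 * (- 1) ^ k"
    if "2 ^ k \<le> n" "n < 2 ^ (k + 1)" for k
    using stern_det_dyadic[OF that] by (simp add: det_stern_matrix)
  \<comment> \<open>The last two claims do not mention k, so a dyadic interval containing n must be
    exhibited.\<close>
  obtain k where "2 ^ k \<le> n" "n < 2 ^ (k + 1)"
    using ex_power_ivl1[of 2 n] assms by auto
  then have abs: "\<bar>det (stern_matrix n)\<bar> = 2"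
    using dyadic by (simp add: abs_mult power_abs)
  then have "invertible (stern_matrix n)"
    by (auto simp: invertible_det_nz)
  with dyadic abs show ?thesis by blast
qed

end
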